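(* If $G$ is a connected graph of order $n$, then $$\rho_1(G)-\rho_2(G)\ \le\ \frac{\rho_2(G)}{n-2},$$ with equality if and only if $G=K_n$ (the complete graph on $n$ vertices).
   Context: All graphs are finite, undirected, simple and connected; the order of a graph is its number of vertices. The distance matrix $\mathcal{D}(G)$ of a graph $G$ on vertices $1,\dots,n$ is the $n\times n$ matrix whose $(i,j)$ entry is the length of a shortest path from $i$ to $j$. A real number $\lambda$ is a Pareto eigenvalue of a real $n\times n$ matrix $A$ if there is a nonzero vector $\mathbf{x}\in\mathbb{R}^n$, $\mathbf{x}\ge 0$ (entrywise), with $A\mathbf{x}\ge\lambda\mathbf{x}$ (entrywise) and $\lambda=\frac{\mathbf{x}^TA\mathbf{x}}{\mathbf{x}^T\mathbf{x}}$. The distance Pareto eigenvalues of $G$ are the Pareto eigenvalues of $\mathcal{D}(G)$. $\rho_k(G)$ denotes the $k$-th largest element of the set of distinct distance Pareto eigenvalues of $G$. *)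

theory Defs
  imports "HOL-Analysis.Analysis" "Graph_Theory.Graph_Theory"
begin

text \<open>
  Graphs are the library's \<^locale>\<open>graph\<close>s: finite symmetric digraphs without loops and
  without parallel arcs, each undirected edge being a pair of opposite arcs.  Matrices are indexed
  by a finite type, so the graphs considered have that whole type as vertex set.

  The constant \<open>\<mu>\<close> is the infimum, in the extended reals, of the costs of the walks between two
  vertices; with unit weights it is the length of a shortest path.  It is finite on a connected
  graph; off connected graphs \<open>real_of_ereal\<close> would send \<open>\<infinity>\<close> to 0.
\<close>

definition distance_matrix :: "('v::finite, 'e) pre_digraph \<Rightarrow> real^'v^'v" where
  "distance_matrix G = (\<chi> i j. real_of_ereal (wf_digraph.\<mu> G (\<lambda>_. 1) i j))"

definition pareto_eigenvalue :: "real^'n^'n \<Rightarrow> real \<Rightarrow> bool" where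
  "pareto_eigenvalue A l \<longleftrightarrow>
    (\<exists>x::real^'n. x \<noteq> 0 \<and> (\<forall>i. 0 \<le> x $ i) \<and>
      (\<forall>i. l * x $ i \<le> (A *v x) $ i) \<and>
      l = (x \<bullet> (A *v x)) / (x \<bullet> x))"

text \<open>
  Positions are counted from 1, and equal values are counted once.  The value is meaningful only
  for finite \<open>S\<close> and \<open>1 \<le> k \<le> card S\<close>.  The set of Pareto eigenvalues of a matrix is finite:
  each of them is an eigenvalue of a principal submatrix.
\<close>

definition kth_largest :: "nat \<Rightarrow> 'a::linorder set \<Rightarrow> 'a" where
  "kth_largest k S = rev (sorted_list_of_set S) ! (k - 1)"

definition distance_pareto_rho :: "nat \<Rightarrow> ('v::finite, 'e) pre_digraph \<Rightarrow> real" where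
  "distance_pareto_rho k G = kth_largest k {l. pareto_eigenvalue (distance_matrix G) l}"

end

theory Submission
  imports Defs
begin

text \<open>
  For a symmetric matrix with zero diagonal and positive off-diagonal entries, the Pareto eigenvalues
  are the spectral radii of the principal submatrices, so \<open>\<rho>\<^sub>1\<close> is the spectral radius and \<open>\<rho>\<^sub>2\<close> bounds
  the Rayleigh quotient of every vector with a vanishing entry. Let \<open>x\<close> be the unit Perron vector and
  let \<open>x\<^sup>i\<close> be \<open>x\<close> with the entry \<open>i\<close> replaced by 0. Then \<open>x\<^sup>i \<bullet> A x\<^sup>i = \<rho>\<^sub>1 (1 - 2 x\<^sub>i\<^sup>2)\<close> and
  \<open>x\<^sup>i \<bullet> x\<^sup>i = 1 - x\<^sub>i\<^sup>2\<close>, so summing \<open>\<rho>\<^sub>1 (1 - 2 x\<^sub>i\<^sup>2) \<le> \<rho>\<^sub>2 (1 - x\<^sub>i\<^sup>2)\<close> over \<open>i\<close> gives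
  \<open>(n - 2) \<rho>\<^sub>1 \<le> (n - 1) \<rho>\<^sub>2\<close>. In the case of equality every \<open>x\<^sup>i\<close> maximizes the Rayleigh quotient
  among the vectors vanishing at \<open>i\<close>, hence \<open>A\<^sub>j\<^sub>i x\<^sub>i = (\<rho>\<^sub>1 - \<rho>\<^sub>2) x\<^sub>j\<close> for all \<open>j \<noteq> i\<close>; exchanging \<open>i\<close>
  and \<open>j\<close> shows that all off-diagonal entries of \<open>A\<close> are \<open>\<rho>\<^sub>1 - \<rho>\<^sub>2\<close>. In a distance matrix of order at
  least 2 this common value is 1.
\<close>

section \<open>Largest and second largest elements of a finite set\<close>

lemma sorted_list_of_set_snoc_Max:
  assumes "finite S" "S \<noteq> {}"
  shows "sorted_list_of_set S = sorted_list_of_set (S - {Max S}) @ [Max S]"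
proof -
  have "sorted (sorted_list_of_set (S - {Max S}) @ [Max S])"
    using assms by (auto simp: sorted_append)
  moreover have "set (sorted_list_of_set (S - {Max S}) @ [Max S]) = S"
    using Max_in[OF assms] assms(1) by (simp add: insert_absorb del: Max_in)
  ultimately show ?thesis
    using assms(1) sorted_list_of_set.idem_if_sorted_distinct[of "sorted_list_of_set (S - {Max S}) @ [Max S]"]
    by simp
qed

lemma kth_largest_1:
  assumes "finite S" "S \<noteq> {}"
  shows "kth_largest 1 S = Max S"
  by (simp add: kth_largest_def sorted_list_of_set_snoc_Max[OF assms])

text \<open>The descending list starts with \<open>Max S\<close>, so its position 1 is position 0 of
  the list for \<open>S - {Max S}\<close>; nonemptiness of that set keeps the index in
  range.\<close>

lemma kth_largest_2:
  assumes "finite S" "S - {Max S} \<noteq> {}"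
  shows "kth_largest 2 S = Max (S - {Max S})"
proof -
  have "S \<noteq> {}" using assms by auto
  then show ?thesis
    using assms kth_largest_1[of "S - {Max S}"]
    by (simp add: kth_largest_def sorted_list_of_set_snoc_Max)
qed

section \<open>Pareto eigenvalues as eigenvalues of principal submatrices\<close>

locale positive_offdiagonal =
  fixes A :: "real^'n^'n"
  assumes sym: "A $ i $ j = A $ j $ i"
    and diag: "A $ i $ i = 0"
    and pos: "i \<noteq> j \<Longrightarrow> 0 < A $ i $ j"
begin

lemma nonneg: "0 \<le> A $ i $ j"
  using diag[of i] pos[of i j] by (cases "i = j") auto

lemma inner_matrix_sym: "x \<bullet> (A *v y) = y \<bullet> (A *v x)"
proof -
  have "transpose A = A" by (simp add: vec_eq_iff transpose_def sym)
  then have "A *v x = x v* A" by (metis transpose_matrix_vector)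
  then show ?thesis by (simp add: dot_lmul_matrix inner_commute[of y])
qed

lemma mult_nonneg_vec: "(\<And>j. 0 \<le> x $ j) \<Longrightarrow> 0 \<le> (A *v x) $ i"
  by (auto simp: matrix_vector_mult_def nonneg intro!: sum_nonneg)

text \<open>Some entry of \<open>x\<close> away from \<open>i\<close> is positive, and row
  \<open>i\<close> of \<open>A\<close> is positive there. This strictness replaces irreducibility in
  the Perron-Frobenius argument.\<close>

lemma mult_pos_vec:
  assumes "\<And>j. 0 \<le> x $ j" "x \<noteq> 0" "x $ i = 0"
  shows "0 < (A *v x) $ i"
proof -
  obtain k where k: "x $ k \<noteq> 0" using assms(2) by (auto simp: vec_eq_iff)
  then have "0 < A $ i $ k * x $ k"
    using assms pos[of i k] by (metis mult_pos_pos order_le_less)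
  then show ?thesis
    unfolding matrix_vector_mult_def
    using assms(1) nonneg by (auto intro!: sum_pos2[of UNIV k])
qed

text \<open>The products of \<open>x $ i\<close> with the slack at \<open>i\<close> are nonnegative
  and sum to zero, so each of them vanishes.\<close>

lemma pareto_complementarity:
  assumes x: "\<And>i. 0 \<le> x $ i" "\<And>i. l * x $ i \<le> (A *v x) $ i" "x \<bullet> (A *v x) = l * (x \<bullet> x)"
    and "x $ i \<noteq> 0"
  shows "(A *v x) $ i = l * x $ i"
proof -
  have "(\<Sum>i\<in>UNIV. x $ i * ((A *v x) $ i - l * x $ i)) = x \<bullet> (A *v x) - l * (x \<bullet> x)"
    by (simp add: inner_vec_def sum_subtractf sum_distrib_left algebra_simps)
  then have "(\<Sum>i\<in>UNIV. x $ i * ((A *v x) $ i - l * x $ i)) = 0"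
    using x(3) by simp
  then have "x $ i * ((A *v x) $ i - l * x $ i) = 0"
    by (subst (asm) sum_nonneg_eq_0_iff) (use x in auto)
  then show ?thesis using \<open>x $ i \<noteq> 0\<close> by simp
qed

text \<open>Off the support of \<open>x\<close> the Pareto inequality reads
  \<open>0 \<le> (A *v x) $ i\<close>, which nonnegativity of \<open>A\<close> gives for free. What
  remains is an eigenvalue equation for the principal submatrix on the support.\<close>

lemma pareto_eigenvalue_iff:
  "pareto_eigenvalue A l \<longleftrightarrow>
    (\<exists>x. x \<noteq> 0 \<and> (\<forall>i. 0 \<le> x $ i) \<and> (\<forall>i. x $ i \<noteq> 0 \<longrightarrow> (A *v x) $ i = l * x $ i))"
    (is "?L \<longleftrightarrow> ?R")
proof
  assume ?L
  then obtain x where x: "x \<noteq> 0" "\<And>i. 0 \<le> x $ i" "\<And>i. l * x $ i \<le> (A *v x) $ i"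
      "l = (x \<bullet> (A *v x)) / (x \<bullet> x)"
    unfolding pareto_eigenvalue_def by blast
  then have "x \<bullet> (A *v x) = l * (x \<bullet> x)" by simp
  then show ?R using x pareto_complementarity[of x l] by blast
next
  assume ?R
  then obtain x where x: "x \<noteq> 0" "\<And>i. 0 \<le> x $ i"
      "\<And>i. x $ i \<noteq> 0 \<Longrightarrow> (A *v x) $ i = l * x $ i"
    by blast
  have "l * x $ i \<le> (A *v x) $ i" for i
    using x mult_nonneg_vec[of x i] by (cases "x $ i = 0") auto
  moreover have "x \<bullet> (A *v x) = (\<Sum>i\<in>UNIV. l * (x $ i * x $ i))"
    unfolding inner_vec_def
  proof (rule sum.cong)
    fix i show "x $ i \<bullet> (A *v x) $ i = l * (x $ i * x $ i)"
      using x(3)[of i] by (cases "x $ i = 0") auto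
  qed simp
  then have "x \<bullet> (A *v x) = l * (x \<bullet> x)"
    by (simp add: inner_vec_def sum_distrib_left)
  ultimately show ?L
    unfolding pareto_eigenvalue_def using x by (intro exI[of _ x]) simp
qed

text \<open>By symmetry of \<open>A\<close>, pairing each vector with the image of the other gives
  \<open>l * (x \<bullet> y) = m * (x \<bullet> y)\<close>; the common support makes
  \<open>x \<bullet> y\<close> positive.\<close>

lemma pareto_same_support:
  assumes x: "x \<noteq> 0" "\<And>i. 0 \<le> x $ i" "\<And>i. x $ i \<noteq> 0 \<Longrightarrow> (A *v x) $ i = l * x $ i"
    and y: "\<And>i. 0 \<le> y $ i" "\<And>i. y $ i \<noteq> 0 \<Longrightarrow> (A *v y) $ i = m * y $ i"
    and supp: "\<And>i. x $ i = 0 \<longleftrightarrow> y $ i = 0"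
  shows "l = m"
proof -
  have "y $ i * (A *v x) $ i = l * (x $ i * y $ i)" for i
    using x(3)[of i] supp[of i] by (cases "x $ i = 0") auto
  then have 1: "y \<bullet> (A *v x) = l * (x \<bullet> y)"
    by (simp only: inner_vec_def sum_distrib_left inner_real_def)
  have "x $ i * (A *v y) $ i = m * (x $ i * y $ i)" for i
    using y(2)[of i] supp[of i] by (cases "x $ i = 0") auto
  then have 2: "x \<bullet> (A *v y) = m * (x \<bullet> y)"
    by (simp only: inner_vec_def sum_distrib_left inner_real_def)
  obtain k where "x $ k \<noteq> 0" using x(1) by (auto simp: vec_eq_iff)
  then have "0 < x $ k * y $ k" using x(2)[of k] y(1)[of k] supp[of k] by (simp add: order_le_less)
  then have "0 < x \<bullet> y"
    unfolding inner_vec_def using x(2) y(1) by (auto intro!: sum_pos2[of UNIV k])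
  then show ?thesis using 1 2 inner_matrix_sym[of x y] by simp
qed

text \<open>A Pareto eigenvalue is determined by the zero set of any witness, and there are finitely
  many index sets.\<close>

lemma finite_pareto: "finite {l. pareto_eigenvalue A l}"
proof -
  define P where "P l x \<longleftrightarrow> x \<noteq> 0 \<and> (\<forall>i. 0 \<le> x $ i) \<and> (\<forall>i. x $ i \<noteq> 0 \<longrightarrow> (A *v x) $ i = l * x $ i)" for l x
  have "\<forall>l. \<exists>x. pareto_eigenvalue A l \<longrightarrow> P l x"
    unfolding P_def using pareto_eigenvalue_iff by metis
  then obtain w where w: "\<And>l. pareto_eigenvalue A l \<Longrightarrow> P l (w l)"
    by metis
  have "inj_on (\<lambda>l. {i. w l $ i = 0}) {l. pareto_eigenvalue A l}"
  proof (rule inj_onI)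
    fix l m assume "l \<in> {l. pareto_eigenvalue A l}" "m \<in> {l. pareto_eigenvalue A l}"
      and "{i. w l $ i = 0} = {i. w m $ i = 0}"
    then show "l = m"
      using pareto_same_support[of "w l" l "w m" m] w[of l] w[of m] unfolding P_def by blast
  qed
  then show ?thesis by (rule inj_on_finite[of _ _ UNIV]) auto
qed

section \<open>Rayleigh quotients on coordinate subspaces and the Perron vector\<close>

text \<open>The form \<open>m * (v \<bullet> v) - v \<bullet> (A *v v)\<close> is nonnegative on the
  subspace and zero at \<open>y\<close>, so its derivative at \<open>y\<close> along the axis
  \<open>j\<close> vanishes.\<close>

lemma rayleigh_maximizer_stationary:
  assumes max: "\<And>v. (\<And>i. i \<notin> J \<Longrightarrow> v $ i = 0) \<Longrightarrow> v \<bullet> (A *v v) \<le> m * (v \<bullet> v)"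
    and y: "\<And>i. i \<notin> J \<Longrightarrow> y $ i = 0" "y \<bullet> (A *v y) = m * (y \<bullet> y)"
    and "j \<in> J"
  shows "(A *v y) $ j = m * y $ j"
proof -
  define e :: "real^'n" where "e = axis j 1"
  define q where "q = m * (e \<bullet> e) - e \<bullet> (A *v e)"
  define b where "b = m * (y \<bullet> e) - e \<bullet> (A *v y)"
  have "e $ i = 0" if "i \<notin> J" for i using that \<open>j \<in> J\<close> by (auto simp: e_def axis_def)
  then have q: "0 \<le> q" unfolding q_def using max[of e] by auto
  \<comment> \<open>Along \<open>y + t *\<^sub>R e\<close> the form equals
    \<open>2 * t * b + t\<^sup>2 * q\<close>. With \<open>q + 1\<close> in place of \<open>q\<close>
    the denominator is nonzero, and the value at this \<open>t\<close> becomes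
    \<open>- t\<^sup>2 * (q + 2)\<close>, which is negative unless \<open>b = 0\<close>.\<close>
  define t where "t = - b / (q + 1)"
  have le: "(y + t *\<^sub>R e) \<bullet> (A *v (y + t *\<^sub>R e)) \<le> m * ((y + t *\<^sub>R e) \<bullet> (y + t *\<^sub>R e))"
    by (rule max) (use y \<open>j \<in> J\<close> in \<open>auto simp: e_def axis_def\<close>)
  have form: "(y + t *\<^sub>R e) \<bullet> (A *v (y + t *\<^sub>R e))
      = y \<bullet> (A *v y) + 2 * t * (e \<bullet> (A *v y)) + t\<^sup>2 * (e \<bullet> (A *v e))"
    using inner_matrix_sym[of y e]
    by (simp add: matrix_vector_right_distrib matrix_vector_mult_scaleR inner_add_left
        inner_add_right power2_eq_square algebra_simps)
  have norm: "(y + t *\<^sub>R e) \<bullet> (y + t *\<^sub>R e) = y \<bullet> y + 2 * t * (y \<bullet> e) + t\<^sup>2 * (e \<bullet> e)"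
    by (simp add: inner_add_left inner_add_right inner_commute[of e y] power2_eq_square algebra_simps)
  have "0 \<le> 2 * t * b + t\<^sup>2 * q"
    using le unfolding form norm y(2) by (simp add: b_def q_def algebra_simps)
  moreover have b: "b = - t * (q + 1)" using q by (simp add: t_def)
  ultimately have "t\<^sup>2 * (q + 2) \<le> 0"
    by (simp add: power2_eq_square algebra_simps)
  then have "t = 0" using q by (simp add: mult_le_0_iff)
  then have "b = 0" using b by simp
  then show ?thesis by (simp add: b_def e_def inner_axis inner_commute[of "axis j 1"])
qed

text \<open>The quotient attains its maximum on the compact unit sphere of the subspace; a
  nonnegative maximizer is then a witness that the maximum is a Pareto eigenvalue.\<close>

lemma exists_rayleigh_maximizer:
  assumes "J \<noteq> {}"
  obtains y m where "norm y = 1" "\<And>i. 0 \<le> y $ i" "\<And>i. i \<notin> J \<Longrightarrow> y $ i = 0"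
    "y \<bullet> (A *v y) = m * (y \<bullet> y)"
    "\<And>v. (\<And>i. i \<notin> J \<Longrightarrow> v $ i = 0) \<Longrightarrow> v \<bullet> (A *v v) \<le> m * (v \<bullet> v)"
    "\<And>j. j \<in> J \<Longrightarrow> (A *v y) $ j = m * y $ j" "pareto_eigenvalue A m"
proof -
  define K where "K = sphere 0 1 \<inter> (\<Inter>i\<in>-J. {v::real^'n. v $ i = 0})"
  have "compact K" unfolding K_def
    by (intro compact_Int_closed closed_INT ballI closed_Collect_eq continuous_intros) auto
  moreover obtain k where "k \<in> J" using assms by blast
  then have "axis k 1 \<in> K" by (auto simp: K_def axis_def[of k] norm_axis_1[unfolded axis_def])
  then have "K \<noteq> {}" by blast
  moreover have "continuous_on K (\<lambda>v. v \<bullet> (A *v v))"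
    by (intro continuous_intros matrix_vector_mult_linear_continuous_on)
  ultimately obtain z where z: "z \<in> K" "\<And>v. v \<in> K \<Longrightarrow> v \<bullet> (A *v v) \<le> z \<bullet> (A *v z)"
    using continuous_attains_sup by metis
  define m where "m = z \<bullet> (A *v z)"
  have max: "v \<bullet> (A *v v) \<le> m * (v \<bullet> v)" if v: "\<And>i. i \<notin> J \<Longrightarrow> v $ i = 0" for v
  proof (cases "v = 0")
    case False
    define u where "u = (1 / norm v) *\<^sub>R v"
    have "u \<in> K" using False v by (auto simp: K_def u_def)
    then have "u \<bullet> (A *v u) \<le> m" unfolding m_def by (rule z)
    moreover have "u \<bullet> (A *v u) = (v \<bullet> (A *v v)) / (v \<bullet> v)"
      by (simp add: u_def matrix_vector_mult_scaleR dot_square_norm power2_eq_square)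
    ultimately show ?thesis using False by (simp add: pos_divide_le_eq)
  qed simp
  \<comment> \<open>Absolute values preserve the norm and the zeros and, as \<open>A\<close> is
    nonnegative, cannot decrease the quadratic form.\<close>
  define y where "y = (\<chi> i. \<bar>z $ i\<bar>)"
  have yy: "y \<bullet> y = z \<bullet> z" by (simp add: y_def inner_vec_def)
  then have norm: "norm y = 1" using z(1) by (simp add: K_def norm_eq_sqrt_inner)
  have y0: "y $ i = 0" if "i \<notin> J" for i using z(1) that by (auto simp: K_def y_def)
  have "z \<bullet> (A *v z) \<le> y \<bullet> (A *v y)"
    unfolding inner_vec_def matrix_vector_mult_def y_def
    by (auto simp: sum_distrib_left nonneg abs_mult intro!: sum_mono)
      (metis abs_ge_self abs_mult abs_of_nonneg nonneg)
  moreover have "y \<bullet> y = 1" using norm by (simp add: norm_eq_1)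
  ultimately have ym: "y \<bullet> (A *v y) = m * (y \<bullet> y)"
    using max[of y] y0 by (simp add: m_def)
  have stat: "(A *v y) $ j = m * y $ j" if "j \<in> J" for j
    using rayleigh_maximizer_stationary[of J m y j] max y0 ym that by blast
  have "pareto_eigenvalue A m" unfolding pareto_eigenvalue_iff
    using norm stat y0 by (intro exI[of _ y]) (auto simp: y_def)
  then show thesis
    using that[of y m] norm y0 ym max stat by (auto simp: y_def)
qed

text \<open>A zero entry of the global maximizer would have a positive image under \<open>A\<close>,
  against the eigenvalue equation. The maximum is the largest Pareto eigenvalue because every Pareto
  eigenvalue is a Rayleigh quotient.\<close>

lemma perron_vector:
  obtains x where "norm x = 1" "\<And>i. 0 < x $ i"
    "A *v x = Max {l. pareto_eigenvalue A l} *\<^sub>R x"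
    "pareto_eigenvalue A (Max {l. pareto_eigenvalue A l})"
proof -
  obtain x m where x: "norm x = 1" "\<And>i. 0 \<le> x $ i" "x \<bullet> (A *v x) = m * (x \<bullet> x)"
      "\<And>v. v \<bullet> (A *v v) \<le> m * (v \<bullet> v)" "\<And>j. (A *v x) $ j = m * x $ j" "pareto_eigenvalue A m"
    using exists_rayleigh_maximizer[of UNIV] by auto
  have "x \<noteq> 0" using x(1) by auto
  then have "x $ i \<noteq> 0" for i
    using mult_pos_vec[of x i] x(2) x(5)[of i] by auto
  then have x0: "0 < x $ i" for i
    using x(2)[of i] by (simp add: order_le_less)
  have "Max {l. pareto_eigenvalue A l} = m"
  proof (rule Max_eqI[OF finite_pareto])
    fix l assume "l \<in> {l. pareto_eigenvalue A l}"
    then obtain v where "v \<noteq> 0" "l = (v \<bullet> (A *v v)) / (v \<bullet> v)"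
      unfolding pareto_eigenvalue_def by auto
    then show "l \<le> m" using x(4)[of v] by (simp add: pos_divide_le_eq)
  qed (simp add: x)
  then show thesis using that[of x] x x0 by (simp add: vec_eq_iff)
qed

text \<open>A witness of full support would share its support with the Perron vector, hence also its
  eigenvalue.\<close>

lemma non_maximal_pareto_support:
  assumes "x \<noteq> 0" "\<And>i. 0 \<le> x $ i" "\<And>i. x $ i \<noteq> 0 \<Longrightarrow> (A *v x) $ i = l * x $ i"
    and "l \<noteq> Max {l. pareto_eigenvalue A l}"
  obtains i where "x $ i = 0"
proof -
  define r where "r = Max {l. pareto_eigenvalue A l}"
  obtain p where p: "\<And>i. 0 < p $ i" "A *v p = r *\<^sub>R p"
    using perron_vector unfolding r_def by metis
  have p0: "0 \<le> p $ i" "p $ i \<noteq> 0" for i using p(1)[of i] by auto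
  have "\<exists>i. x $ i = 0"
  proof (rule ccontr)
    assume "\<not> (\<exists>i. x $ i = 0)"
    then have "l = r"
      using pareto_same_support[of x l p r] assms(1-3) p(2) p0 by auto
    then show False using assms(4) by (simp add: r_def)
  qed
  then show thesis using that by blast
qed

section \<open>The second largest Pareto eigenvalue and the gap\<close>

text \<open>The maximal Rayleigh quotient over the vectors vanishing at \<open>i\<close> is a Pareto
  eigenvalue strictly below the largest one, hence at most the second.\<close>

lemma second_rho_bound:
  assumes "2 \<le> CARD('n)"
  shows "kth_largest 2 {l. pareto_eigenvalue A l} \<noteq> kth_largest 1 {l. pareto_eigenvalue A l}"
    and "pareto_eigenvalue A (kth_largest 2 {l. pareto_eigenvalue A l})"
    and "\<And>v. v $ i = 0 \<Longrightarrow> v \<bullet> (A *v v) \<le> kth_largest 2 {l. pareto_eigenvalue A l} * (v \<bullet> v)"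
proof -
  define S where "S = {l. pareto_eigenvalue A l}"
  have fin: "finite S" by (simp add: S_def finite_pareto)
  have S: "S \<noteq> {}" using perron_vector unfolding S_def by blast
  have *: "\<exists>m \<in> S - {Max S}. \<forall>v. v $ i = 0 \<longrightarrow> v \<bullet> (A *v v) \<le> m * (v \<bullet> v)" for i
  proof -
    have "UNIV - {i} \<noteq> {}"
      using assms by (metis Diff_eq_empty_iff card_mono card_1_singleton_iff finite.emptyI
          finite_insert is_singletonI is_singleton_altdef not_less_eq_eq numeral_2_eq_2 One_nat_def)
    then obtain y m where y: "norm y = 1" "\<And>j. 0 \<le> y $ j" "y $ i = 0"
        "y \<bullet> (A *v y) = m * (y \<bullet> y)" "\<And>v. v $ i = 0 \<Longrightarrow> v \<bullet> (A *v v) \<le> m * (v \<bullet> v)"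
        "\<And>j. j \<noteq> i \<Longrightarrow> (A *v y) $ j = m * y $ j" "pareto_eigenvalue A m"
      using exists_rayleigh_maximizer[of "UNIV - {i}"] by auto
    \<comment> \<open>Otherwise pair \<open>y\<close> with the Perron vector \<open>x\<close>: the
      coordinates other than \<open>i\<close> already add up to \<open>y \<bullet> (A *v x)\<close>,
      so symmetry leaves \<open>x $ i * (A *v y) $ i = 0\<close>, although both factors are
      positive.\<close>
    have "m \<noteq> Max S"
    proof
      assume m: "m = Max S"
      obtain x where x: "\<And>j. 0 < x $ j" "A *v x = m *\<^sub>R x"
        using perron_vector unfolding m S_def by metis
      have "y \<bullet> (A *v x) = x \<bullet> (A *v y)" by (rule inner_matrix_sym)
      also have "\<dots> = (\<Sum>j\<in>UNIV. m * (y $ j * x $ j) + (if j = i then x $ i * (A *v y) $ i else 0))"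
        unfolding inner_vec_def by (rule sum.cong) (auto simp: y)
      also have "\<dots> = y \<bullet> (A *v x) + x $ i * (A *v y) $ i"
        by (simp add: sum.distrib x(2) inner_vec_def sum_distrib_left mult.left_commute)
      finally have "x $ i * (A *v y) $ i = 0" by simp
      moreover have "y \<noteq> 0" using y(1) by auto
      then have "0 < (A *v y) $ i" using mult_pos_vec[of y i] y(2,3) by auto
      ultimately show False using x(1)[of i] by simp
    qed
    then show ?thesis using y(5,7) by (auto simp: S_def)
  qed
  \<comment> \<open>A second value exists, so \<open>kth_largest 2 S\<close> is not an out-of-range
    list access.\<close>
  have ne: "S - {Max S} \<noteq> {}" using *[of i] by blast
  note k = kth_largest_2[OF fin ne] kth_largest_1[OF fin S]
  have "Max (S - {Max S}) \<in> S - {Max S}" using fin ne by (intro Max_in) auto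
  then have "kth_largest 2 S \<noteq> kth_largest 1 S" "kth_largest 2 S \<in> S"
    unfolding k by blast+
  then show "kth_largest 2 {l. pareto_eigenvalue A l} \<noteq> kth_largest 1 {l. pareto_eigenvalue A l}"
    "pareto_eigenvalue A (kth_largest 2 {l. pareto_eigenvalue A l})"
    unfolding S_def by blast+
  fix v :: "real^'n" assume v: "v $ i = 0"
  obtain m where m: "m \<in> S - {Max S}" "v \<bullet> (A *v v) \<le> m * (v \<bullet> v)" using *[of i] v by blast
  then have "m \<le> kth_largest 2 S" using fin by (simp only: k) (intro Max_ge, auto)
  then have "m * (v \<bullet> v) \<le> kth_largest 2 S * (v \<bullet> v)" by (intro mult_right_mono) auto
  then show "v \<bullet> (A *v v) \<le> kth_largest 2 {l. pareto_eigenvalue A l} * (v \<bullet> v)"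
    using m by (simp add: S_def)
qed

lemma rho_gap:
  fixes \<rho>1 \<rho>2 :: real
  assumes n: "2 \<le> CARD('n)"
  defines "\<rho>1 \<equiv> kth_largest 1 {l. pareto_eigenvalue A l}"
    and "\<rho>2 \<equiv> kth_largest 2 {l. pareto_eigenvalue A l}"
  shows "(real CARD('n) - 2) * \<rho>1 \<le> (real CARD('n) - 1) * \<rho>2" (is ?ineq)
    and "(real CARD('n) - 2) * \<rho>1 = (real CARD('n) - 1) * \<rho>2
      \<longleftrightarrow> (\<exists>c. \<forall>i j. i \<noteq> j \<longrightarrow> A $ i $ j = c)" (is "?eq \<longleftrightarrow> ?const")
proof -
  have \<rho>1: "\<rho>1 = Max {l. pareto_eigenvalue A l}"
    unfolding \<rho>1_def using perron_vector by (intro kth_largest_1 finite_pareto) blast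
  obtain x where x: "norm x = 1" "\<And>i. 0 < x $ i" "A *v x = \<rho>1 *\<^sub>R x"
    using perron_vector unfolding \<rho>1 by metis
  have xx: "x \<bullet> x = 1" using x(1) by (simp add: norm_eq_1)
  \<comment> \<open>The truncated Perron vector \<open>x\<^sup>i\<close>, written as a difference so
    that linearity yields its norm and its quadratic form.\<close>
  define z where "z i = x - x $ i *\<^sub>R axis i 1" for i
  have zi: "z i $ i = 0" "j \<noteq> i \<Longrightarrow> z i $ j = x $ j" for i j by (auto simp: z_def axis_def)
  have Ae: "(A *v axis i 1) $ j = A $ j $ i" for i j
    by (simp add: matrix_vector_mult_basis column_def)
  have xe: "x \<bullet> axis i 1 = x $ i" for i by (simp add: inner_axis)
  have zz: "z i \<bullet> z i = 1 - (x $ i)\<^sup>2" for i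
    by (simp add: z_def inner_diff_left inner_diff_right xx inner_commute[of "axis i 1"] xe
        inner_axis_axis power2_eq_square)
  have Az: "A *v z i = \<rho>1 *\<^sub>R x - x $ i *\<^sub>R (A *v axis i 1)" for i
    by (simp add: z_def matrix_vector_mult_diff_distrib matrix_vector_mult_scaleR x(3))
  have zAz: "z i \<bullet> (A *v z i) = \<rho>1 * (1 - 2 * (x $ i)\<^sup>2)" for i
  proof -
    have "axis i 1 \<bullet> (A *v axis i 1) = 0"
      by (simp add: inner_commute[of "axis i 1"] inner_axis Ae diag)
    moreover have "x \<bullet> (A *v axis i 1) = \<rho>1 * x $ i"
      by (subst inner_matrix_sym) (simp add: x(3) inner_commute[of "axis i 1"] xe)
    ultimately show ?thesis
      unfolding Az by (simp add: z_def inner_diff_left inner_diff_right xx xe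
          inner_commute[of "axis i 1" x] power2_eq_square algebra_simps)
  qed
  have bound: "v \<bullet> (A *v v) \<le> \<rho>2 * (v \<bullet> v)" if "v $ i = 0" for v i
    unfolding \<rho>2_def by (rule second_rho_bound(3)[OF n that])
  have le: "\<rho>1 * (1 - 2 * (x $ i)\<^sup>2) \<le> \<rho>2 * (1 - (x $ i)\<^sup>2)" for i
    using bound[OF zi(1), of i] by (simp add: zAz zz)
  have x2: "(\<Sum>i\<in>UNIV. (x $ i)\<^sup>2) = 1"
    using xx by (simp add: inner_vec_def power2_eq_square)
  have s1: "(\<Sum>i\<in>UNIV. \<rho>1 * (1 - 2 * (x $ i)\<^sup>2)) = (real CARD('n) - 2) * \<rho>1"
    by (simp add: sum_distrib_left[symmetric] sum_subtractf x2)
  have s2: "(\<Sum>i\<in>UNIV. \<rho>2 * (1 - (x $ i)\<^sup>2)) = (real CARD('n) - 1) * \<rho>2"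
    by (simp add: sum_distrib_left[symmetric] sum_subtractf x2)
  show ineq: ?ineq
    unfolding s1[symmetric] s2[symmetric] by (rule sum_mono) (rule le)
  show "?eq \<longleftrightarrow> ?const"
  proof
    assume ?eq
    \<comment> \<open>All summands are nonnegative, so equality of the sums forces equality for
      every \<open>i\<close>.\<close>
    then have "(\<Sum>i\<in>UNIV. \<rho>2 * (1 - (x $ i)\<^sup>2) - \<rho>1 * (1 - 2 * (x $ i)\<^sup>2)) = 0"
      by (simp only: sum_subtractf s1 s2)
    then have eq: "\<rho>2 * (1 - (x $ i)\<^sup>2) = \<rho>1 * (1 - 2 * (x $ i)\<^sup>2)" for i
      by (subst (asm) sum_nonneg_eq_0_iff) (use le in auto)
    have A: "A $ j $ i * x $ i = (\<rho>1 - \<rho>2) * x $ j" if "i \<noteq> j" for i j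
    proof -
      have "(A *v z i) $ j = \<rho>2 * z i $ j"
      proof (rule rayleigh_maximizer_stationary[where J = "UNIV - {i}"])
        show "z i \<bullet> (A *v z i) = \<rho>2 * (z i \<bullet> z i)" by (simp add: zAz zz eq)
      qed (use that bound[of _ i] zi in auto)
      then show ?thesis using that zi(2)[of j i] by (simp add: Az Ae algebra_simps)
    qed
    have "A $ i $ j = \<rho>1 - \<rho>2" if "i \<noteq> j" for i j
    proof -
      \<comment> \<open>Using the relation for \<open>(i, j)\<close> and then for
        \<open>(j, i)\<close> cancels the Perron entries and determines the square of
        \<open>A $ i $ j\<close>; positivity settles the sign.\<close>
      have "A $ i $ j * (A $ i $ j * x $ i) = A $ i $ j * ((\<rho>1 - \<rho>2) * x $ j)"
        using A[of i j] that by (simp add: sym[of j i])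
      also have "\<dots> = (\<rho>1 - \<rho>2) * ((\<rho>1 - \<rho>2) * x $ i)"
        using A[of j i] that by (simp add: mult.left_commute)
      finally have "(A $ i $ j)\<^sup>2 = (\<rho>1 - \<rho>2)\<^sup>2"
        using x(2)[of i] by (simp add: power2_eq_square)
      moreover have "0 < A $ i $ j" using pos that by blast
      moreover have "0 < (\<rho>1 - \<rho>2) * x $ j"
        using A[of i j] that pos[of j i] x(2)[of i] by (metis mult_pos_pos)
      then have "0 < \<rho>1 - \<rho>2" using x(2)[of j] by (simp add: zero_less_mult_iff)
      ultimately show ?thesis by (simp add: power2_eq_iff_nonneg)
    qed
    then show ?const by blast
  next
    assume ?const
    then obtain c where c: "\<And>i j. i \<noteq> j \<Longrightarrow> A $ i $ j = c" by blast
    have mult: "(A *v v) $ i = c * ((\<Sum>j\<in>UNIV. v $ j) - v $ i)" for v i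
    proof -
      have "(A *v v) $ i = (\<Sum>j\<in>UNIV. c * (v $ j - (if j = i then v $ i else 0)))"
        unfolding matrix_vector_mult_def using c by (auto simp: diag intro!: sum.cong)
      then show ?thesis by (simp add: sum_distrib_left[symmetric] sum_subtractf)
    qed
    \<comment> \<open>The indicator vector of the support of \<open>v\<close> satisfies the
      eigenvalue equation on that support with this value, so \<open>l\<close> must agree with
      it.\<close>
    have indicator: "l = c * (real (card {i. v $ i \<noteq> 0}) - 1)"
      if "v \<noteq> 0" "\<And>i. 0 \<le> v $ i" "\<And>i. v $ i \<noteq> 0 \<Longrightarrow> (A *v v) $ i = l * v $ i" for v l
    proof (rule pareto_same_support[OF that])
      fix i
      show "(A *v (\<chi> i. if v $ i \<noteq> 0 then 1 else 0)) $ i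
        = c * (real (card {i. v $ i \<noteq> 0}) - 1) * (\<chi> i. if v $ i \<noteq> 0 then 1 else 0) $ i"
        if "(\<chi> i. if v $ i \<noteq> 0 then 1 else 0) $ i \<noteq> (0::real)"
        using that by (cases "v $ i = 0") (simp_all add: mult sum.If_cases)
    qed auto
    have "{i. x $ i \<noteq> 0} = UNIV" using x(2) by (auto simp: order_less_le)
    moreover have "x \<noteq> 0" using x(1) by auto
    ultimately have "\<rho>1 = c * (real CARD('n) - 1)"
      using indicator[of x \<rho>1] x by (auto simp: order_less_imp_le)
    \<comment> \<open>A witness for \<open>\<rho>2\<close> has a zero entry, so its support has at
      most \<open>CARD('n) - 1\<close> elements. An upper bound suffices, since \<open>ineq\<close>
      supplies the other direction.\<close>
    moreover have "\<rho>2 \<le> c * (real CARD('n) - 2)"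
    proof -
      obtain v where v: "v \<noteq> 0" "\<And>i. 0 \<le> v $ i" "\<And>i. v $ i \<noteq> 0 \<Longrightarrow> (A *v v) $ i = \<rho>2 * v $ i"
        using second_rho_bound(2)[OF n] unfolding pareto_eigenvalue_iff \<rho>2_def by blast
      moreover have "\<rho>2 \<noteq> Max {l. pareto_eigenvalue A l}"
        using second_rho_bound(1)[OF n] \<rho>1 unfolding \<rho>2_def \<rho>1_def by simp
      ultimately obtain i where i: "v $ i = 0"
        using non_maximal_pareto_support by blast
      then have "{i. v $ i \<noteq> 0} \<subset> UNIV" by auto
      then have "card {i. v $ i \<noteq> 0} < CARD('n)" by (intro psubset_card_mono) auto
      then have "real (card {i. v $ i \<noteq> 0}) - 1 \<le> real CARD('n) - 2" by linarith
      moreover obtain k where "v $ k \<noteq> 0" using v(1) by (auto simp: vec_eq_iff)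
      then have "0 < c" using pos[of i k] c[of i k] i by metis
      ultimately show ?thesis using indicator[OF v] by simp
    qed
    then have "(real CARD('n) - 1) * \<rho>2 \<le> (real CARD('n) - 1) * (c * (real CARD('n) - 2))"
      using n by (intro mult_left_mono) auto
    ultimately show ?eq using ineq by (simp add: mult_ac)
  qed
qed

end

section \<open>Distances in connected graphs\<close>

context graph
begin

lemma strongly_connected_if_connected:
  assumes "Digraph_Component.connected G"
  shows "strongly_connected G"
  using assms symmetric_connected_imp_strongly_connected sym_arcs by blast

text \<open>Every arc has an opposite arc, and the opposites in reverse order form the walk back.
  This makes the distance matrix symmetric.\<close>

lemma awalk_reverse:
  assumes "awalk u p v"
  obtains q where "awalk v q u" "length q = length p"
proof -
  have "\<exists>q. awalk v q u \<and> length q = length p"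
    using assms
  proof (induction p arbitrary: u)
    case Nil
    then show ?case by (auto simp: awalk_Nil_iff)
  next
    case (Cons e p)
    then have e: "e \<in> arcs G" "u = tail G e" "awalk (head G e) p v"
      by (auto simp: awalk_Cons_iff)
    then obtain q where q: "awalk v q (head G e)" "length q = length p"
      using Cons.IH by blast
    obtain f where "f \<in> arcs G" "tail G f = head G e" "head G f = tail G e"
      using sym_arcs e(1) unfolding symmetric_conv by metis
    then have "awalk (head G e) [f] u"
      using e by (auto simp: awalk_simps)
    then have "awalk v (q @ [f]) u" using q by (blast intro: awalk_appendI)
    then show ?case using q by (intro exI[of _ "q @ [f]"]) simp
  qed
  then show thesis using that by blast
qed

lemma awalk_cost_unit: "awalk_cost (\<lambda>_. 1) p = real (length p)"
  by (induction p) auto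

text \<open>Reachability makes the infimum of the walk costs a minimum, so
  \<open>real_of_ereal\<close> returns the length of an actual walk and not the default value for
  infinity.\<close>

lemma distance_attained:
  assumes "u \<rightarrow>\<^sup>* v"
  obtains p where "awalk u p v" "real_of_ereal (\<mu> (\<lambda>_. 1) u v) = real (length p)"
    "\<And>q. awalk u q v \<Longrightarrow> length p \<le> length q"
proof -
  obtain p where p: "apath u p v" "\<mu> (\<lambda>_. 1) u v = awalk_cost (\<lambda>_. 1) p"
    using min_cost_awalk[OF assms, of "\<lambda>_. 1"] by auto
  have "length p \<le> length q" if "awalk u q v" for q
    using min_cost_le_walk_cost[OF that, of "\<lambda>_. 1"] p(2) by (simp add: awalk_cost_unit)
  then show thesis using that[of p] p by (auto simp: awalk_cost_unit apath_def)
qed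

end

text \<open>Everything is read off from shortest walks: the empty walk joins a vertex only to
  itself, and a walk of length one is an arc.\<close>

lemma
  fixes G :: "('v::finite, 'e) pre_digraph"
  assumes "graph G" "Digraph_Component.connected G" "verts G = UNIV"
  shows positive_offdiagonal_distance_matrix: "positive_offdiagonal (distance_matrix G)"
    and distance_matrix_eq_1_iff:
      "i \<noteq> j \<Longrightarrow> distance_matrix G $ i $ j = 1 \<longleftrightarrow> (i, j) \<in> arcs_ends G"
proof -
  interpret graph G by fact
  have reach: "u \<rightarrow>\<^sup>*\<^bsub>G\<^esub> v" for u v
    using strongly_connected_if_connected[OF assms(2)] assms(3)
    by (auto simp: strongly_connected_def)
  have D: "\<exists>p. awalk u p v \<and> distance_matrix G $ u $ v = real (length p)
      \<and> (\<forall>q. awalk u q v \<longrightarrow> length p \<le> length q)" for u v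
    using distance_attained[OF reach[of u v]] by (auto simp: distance_matrix_def)
  have le: "distance_matrix G $ u $ v \<le> distance_matrix G $ v $ u" for u v
    using D[of u v] D[of v u] by (metis awalk_reverse of_nat_le_iff)
  show "positive_offdiagonal (distance_matrix G)"
  proof
    fix i j
    show "distance_matrix G $ i $ j = distance_matrix G $ j $ i"
      using le by (intro antisym)
    have "awalk i [] i" using assms(3) by (simp add: awalk_Nil_iff)
    then show "distance_matrix G $ i $ i = 0" using D[of i i] by auto
    show "0 < distance_matrix G $ i $ j" if "i \<noteq> j"
      using D[of i j] that by (auto simp: awalk_Nil_iff)
  qed
  assume "i \<noteq> j"
  show "distance_matrix G $ i $ j = 1 \<longleftrightarrow> (i, j) \<in> arcs_ends G"
  proof
    assume "distance_matrix G $ i $ j = 1"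
    then obtain p where "awalk i p j" "length p = Suc 0" using D[of i j] by auto
    then show "(i, j) \<in> arcs_ends G"
      by (auto simp: length_Suc_conv awalk_simps arcs_ends_conv)
  next
    assume "(i, j) \<in> arcs_ends G"
    then obtain e where "awalk i [e] j"
      using assms(3) by (auto simp: arcs_ends_conv awalk_simps)
    moreover obtain p where p: "awalk i p j" "distance_matrix G $ i $ j = real (length p)"
        "\<And>q. awalk i q j \<Longrightarrow> length p \<le> length q"
      using D by blast
    moreover have "p \<noteq> []" using p(1) \<open>i \<noteq> j\<close> by (auto simp: awalk_Nil_iff)
    ultimately show "distance_matrix G $ i $ j = 1"
      by (metis One_nat_def Suc_leI antisym length_Cons length_greater_0_conv list.size(3) of_nat_1)
  qed
qed

text \<open>A walk between distinct vertices is nonempty. One arc is enough to identify the common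
  off-diagonal distance as 1.\<close>

lemma (in graph) exists_arc:
  assumes "Digraph_Component.connected G" "u \<in> verts G" "v \<in> verts G" "u \<noteq> v"
  obtains a b where "(a, b) \<in> arcs_ends G"
proof -
  have "u \<rightarrow>\<^sup>* v"
    using strongly_connected_if_connected[OF assms(1)] assms by (auto simp: strongly_connected_def)
  then obtain p where "awalk u p v" by (auto simp: reachable_awalk)
  with \<open>u \<noteq> v\<close> obtain e where "e \<in> arcs G"
    by (cases p) (auto simp: awalk_simps)
  then show thesis using that by (auto simp: arcs_ends_def arc_to_ends_def)
qed

theorem theorem3p7:
  fixes G :: "('v::finite, 'e) pre_digraph" and n :: nat
  assumes "graph G" and "Digraph_Component.connected G"
    and "verts G = UNIV" and "card (verts G) = n" and "n \<ge> 3"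
  shows "distance_pareto_rho 1 G - distance_pareto_rho 2 G
           \<le> distance_pareto_rho 2 G / (real n - 2) \<and>
         (distance_pareto_rho 1 G - distance_pareto_rho 2 G
           = distance_pareto_rho 2 G / (real n - 2) \<longleftrightarrow> complete_digraph n G)"
proof -
  interpret graph G by fact
  interpret D: positive_offdiagonal "distance_matrix G"
    using assms(1-3) by (rule positive_offdiagonal_distance_matrix)
  have n: "CARD('v) = n" using assms by simp
  have eq_1: "distance_matrix G $ i $ j = 1 \<longleftrightarrow> (i, j) \<in> arcs_ends G" if "i \<noteq> j" for i j
    using distance_matrix_eq_1_iff[OF assms(1-3) that] .
  \<comment> \<open>The other inclusion, that arcs join distinct vertices, is the absence of
    loops.\<close>
  have "complete_digraph n G \<longleftrightarrow> (\<forall>i j. i \<noteq> j \<longrightarrow> (i, j) \<in> arcs_ends G)"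
    unfolding complete_digraph_def using assms by (auto dest: adj_not_same)
  also have "\<dots> \<longleftrightarrow> (\<exists>c. \<forall>i j. i \<noteq> j \<longrightarrow> distance_matrix G $ i $ j = c)"
  proof
    assume "\<exists>c. \<forall>i j. i \<noteq> j \<longrightarrow> distance_matrix G $ i $ j = c"
    then obtain c where c: "\<And>i j. i \<noteq> j \<Longrightarrow> distance_matrix G $ i $ j = c" by blast
    obtain u v :: 'v where "u \<noteq> v"
      using n \<open>n \<ge> 3\<close> card_le_Suc0_iff_eq[of "UNIV :: 'v set"] by auto
    then obtain a b where "(a, b) \<in> arcs_ends G"
      using exists_arc[OF assms(2), of u v] assms(3) by auto
    moreover from this have "a \<noteq> b" using adj_not_same by blast
    ultimately have "c = 1" using c eq_1 by metis
    then show "\<forall>i j. i \<noteq> j \<longrightarrow> (i, j) \<in> arcs_ends G" using c eq_1 by metis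
  qed (use eq_1 in blast)
  finally have complete: "complete_digraph n G \<longleftrightarrow> \<dots>" .
  have "2 \<le> CARD('v)" using n \<open>n \<ge> 3\<close> by simp
  note gap = D.rho_gap[OF this, unfolded n, folded distance_pareto_rho_def]
  have k: "0 < real n - 2" using \<open>n \<ge> 3\<close> by simp
  \<comment> \<open>Multiplying by the positive number \<open>real n - 2\<close> and collecting the
    multiples of \<open>b\<close> turns the fractional form into that of
    \<open>rho_gap\<close>.\<close>
  have
    "a - b \<le> b / (real n - 2) \<longleftrightarrow> (real n - 2) * a \<le> (real n - 1) * b"
    "a - b = b / (real n - 2) \<longleftrightarrow> (real n - 2) * a = (real n - 1) * b" for a b :: real
    unfolding pos_le_divide_eq[OF k] nonzero_eq_divide_eq[OF less_imp_neq[OF k, symmetric]]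
    by (auto simp: algebra_simps)
  then show ?thesis using gap unfolding complete by (simp only: simp_thms)
qed

end
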